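(* Let $p_1>0$, $p_4>0$, $\rho>0$, and consider the system $$\mathcal{D}'=2p_1\mathcal{I}\mathcal{D},\qquad\mathcal{R}'=2p_1\mathcal{I}\mathcal{R}-2p_4\rho\,\mathcal{I},\qquad\mathcal{I}'=-2p_1(\mathcal{D}^2+\mathcal{R}^2)+2p_4\rho\,\mathcal{R}$$ on $S^2_\rho$. Write $\kappa=p_4/p_1$ and $(\mathcal{D}_0,\mathcal{R}_0,\mathcal{I}_0)=(\mathcal{D}(0),\mathcal{R}(0),\mathcal{I}(0))$. (1) Suppose $p_1>p_4$. The two points $(0,\kappa\rho,\pm\rho\sqrt{1-\kappa^2})$ are fixed points. If $(\mathcal{D}_0,\mathcal{R}_0,\mathcal{I}_0)$ is not one of these fixed points, then, with $\Lambda=\sqrt{(\kappa\rho-\mathcal{R}_0)^2+(1-\kappa^2)\mathcal{D}_0^2}$ and $\omega=2p_1\rho\sqrt{1-\kappa^2}$, $$\mathcal{D}(\tau)=\tfrac{(1-\kappa^2)\rho\,\mathcal{D}_0}{\Lambda\cosh(\omega\tau-\tau_0)-\kappa(\kappa\rho-\mathcal{R}_0)},\qquad\mathcal{R}(\tau)=\kappa\rho+\tfrac{(1-\kappa^2)\rho(\mathcal{R}_0-\kappa\rho)}{\Lambda\cosh(\omega\tau-\tau_0)-\kappa(\kappa\rho-\mathcal{R}_0)},$$ $$\mathcal{I}(\tau)=-\tfrac{\rho\sqrt{1-\kappa^2}\,\Lambda\sinh(\omega\tau-\tau_0)}{\Lambda\cosh(\omega\tau-\tau_0)-\kappa(\kappa\rho-\mathcal{R}_0)},$$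 where $\tau_0\in\mathbb{R}$ is such that $\tau_0\mathcal{I}_0\ge0$ and $\frac{(1-\kappa^2)\rho}{\Lambda\cosh(\tau_0)-\kappa(\kappa\rho-\mathcal{R}_0)}=1$. Any non-equilibrium solution satisfies $(\mathcal{D},\mathcal{R},\mathcal{I})(\tau)\to(0,\kappa\rho,\mp\rho\sqrt{1-\kappa^2})$ as $\tau\to\pm\infty$. (2) Suppose $p_1=p_4$. The point $(0,\rho,0)$ is the unique fixed point. If $(\mathcal{D}_0,\mathcal{R}_0,\mathcal{I}_0)$ is not the fixed point, then, with $G=2\rho(\rho-\mathcal{R}_0)$, $$\mathcal{D}(\tau)=\tfrac{G\,\mathcal{D}_0}{(p_1G\tau-\mathcal{I}_0)^2+G-\mathcal{I}_0^2},\qquad\mathcal{R}(\tau)=\rho-\tfrac{2\rho(\rho-\mathcal{R}_0)^2}{(p_1G\tau-\mathcal{I}_0)^2+G-\mathcal{I}_0^2},\qquad\mathcal{I}(\tau)=-\tfrac{G(p_1G\tau-\mathcal{I}_0)}{(p_1G\tau-\mathcal{I}_0)^2+G-\mathcal{I}_0^2}.$$ Any solution satisfies $(\mathcal{D},\mathcal{R},\mathcal{I})(\tau)\to(0,\rho,0)$ as $\tau\to\pm\infty$. (3) Suppose $p_1<p_4$. The two points $(\pm\rho\sqrt{1-\kappa^{-2}},\kappa^{-1}\rho,0)$ are fixed points. If $(\mathcal{D}_0,\mathcal{R}_0,\mathcal{I}_0)$ is not one of these fixed points, then, with $\Lambda=\sqrt{(\kappa\rho-\mathcal{R}_0)^2-(\kappa^2-1)\mathcal{D}_0^2}$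 and $\omega=2p_1\rho\sqrt{\kappa^2-1}$, $$\mathcal{D}(\tau)=\tfrac{(\kappa^2-1)\rho\,\mathcal{D}_0}{\kappa(\kappa\rho-\mathcal{R}_0)-\Lambda\cos(\omega\tau-\tau_0)},\qquad\mathcal{R}(\tau)=\kappa\rho+\tfrac{(\kappa^2-1)\rho(\mathcal{R}_0-\kappa\rho)}{\kappa(\kappa\rho-\mathcal{R}_0)-\Lambda\cos(\omega\tau-\tau_0)},$$ $$\mathcal{I}(\tau)=-\tfrac{\rho\sqrt{\kappa^2-1}\,\Lambda\sin(\omega\tau-\tau_0)}{\kappa(\kappa\rho-\mathcal{R}_0)-\Lambda\cos(\omega\tau-\tau_0)},$$ where $\tau_0\in(-\pi,\pi]$ is given by $\tau_0\mathcal{I}_0\ge0$ and $\frac{(\kappa^2-1)\rho}{\kappa(\kappa\rho-\mathcal{R}_0)-\Lambda\cos\tau_0}=1$. Any non-equilibrium solution is periodic in $\tau$.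
   Context: $S^2_\rho=\{(x,y,z)\in\mathbb{R}^3: x^2+y^2+z^2=\rho^2\}$; the unknown $(\mathcal{D},\mathcal{R},\mathcal{I})$ is real valued with initial data in $S_\rho^2$, $\tau\in\mathbb{R}$, and the system preserves $S^2_\rho$. *)

theory Defs
  imports "HOL-Analysis.Analysis" "HOL-Library.Periodic_Fun"
begin

definition S2 :: "real \<Rightarrow> (real \<times> real \<times> real) set" where
  "S2 \<rho> = {(x, y, z). x\<^sup>2 + y\<^sup>2 + z\<^sup>2 = \<rho>\<^sup>2}"

text \<open>Right-hand side of the system at the point \<open>(D, R, I)\<close>.\<close>

definition vfield ::
  "real \<Rightarrow> real \<Rightarrow> real \<Rightarrow> real \<times> real \<times> real \<Rightarrow> real \<times> real \<times> real" where
  "vfield p1 p4 \<rho> = (\<lambda>(D, R, I).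
     (2 * p1 * I * D,
      2 * p1 * I * R - 2 * p4 * \<rho> * I,
      - 2 * p1 * (D\<^sup>2 + R\<^sup>2) + 2 * p4 * \<rho> * R))"

text \<open>The phase space is the sphere, so fixed points are required to lie on it
  (the vector field also vanishes at the origin).\<close>

definition fixed_point :: "real \<Rightarrow> real \<Rightarrow> real \<Rightarrow> real \<times> real \<times> real \<Rightarrow> bool" where
  "fixed_point p1 p4 \<rho> q \<longleftrightarrow> q \<in> S2 \<rho> \<and> vfield p1 p4 \<rho> q = (0, 0, 0)"

text \<open>Only the initial value is required to lie on the sphere; that the whole trajectory
  stays there is a property of the system.\<close>

definition solution :: "real \<Rightarrow> real \<Rightarrow> real \<Rightarrow> (real \<Rightarrow> real \<times> real \<times> real) \<Rightarrow> bool" where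
  "solution p1 p4 \<rho> X \<longleftrightarrow>
     X 0 \<in> S2 \<rho> \<and> (\<forall>\<tau>. (X has_vector_derivative vfield p1 p4 \<rho> (X \<tau>)) (at \<tau>))"

definition nonequilibrium_solution ::
  "real \<Rightarrow> real \<Rightarrow> real \<Rightarrow> (real \<Rightarrow> real \<times> real \<times> real) \<Rightarrow> bool" where
  "nonequilibrium_solution p1 p4 \<rho> X \<longleftrightarrow>
     solution p1 p4 \<rho> X \<and> \<not> (\<exists>q. fixed_point p1 p4 \<rho> q \<and> (\<forall>\<tau>. X \<tau> = q))"

end

theory Submission
  imports Defs "HOL-Real_Asymp.Real_Asymp"
begin

text \<open>The vector field is tangent to the sphere, so trajectories stay bounded and a Gronwall estimate
  for the squared distance of two solutions gives uniqueness. It then suffices to exhibit one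
  solution per initial value. The equation for \<open>D\<close> and that for \<open>R - \<kappa> \<rho>\<close> are both
  \<open>u' = 2 p1 I u\<close>, so both functions are constant multiples of \<open>1 / q\<close> with \<open>I = - q' / (2 p1 q)\<close>;
  the remaining equation for \<open>q\<close> is solved by a constant plus a multiple of \<open>cosh\<close>, by a quadratic
  polynomial, or by a constant plus a multiple of \<open>cos\<close>, according to the sign of \<open>1 - \<kappa>\<close>.\<close>

section \<open>Invariance of the sphere and uniqueness of solutions\<close>

text \<open>Gronwall in both time directions. The weight \<open>exp (- C * t)\<close> makes the
  product with \<open>f\<close> nonincreasing, so after time 0 it is at most its value 0 there, and
  \<open>f \<ge> 0\<close> leaves only 0. Before time 0 the weight \<open>exp (C * t)\<close> makes
  the product nondecreasing, with the same outcome.\<close>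

lemma eq_zero_if_deriv_bound:
  fixes f f' :: "real \<Rightarrow> real"
  assumes deriv: "\<And>t. (f has_real_derivative f' t) (at t)"
    and bound: "\<And>t. \<bar>f' t\<bar> \<le> C * f t"
    and nonneg: "\<And>t. f t \<ge> 0"
    and zero: "f 0 = 0"
  shows "f t = 0"
proof (cases "t \<ge> 0")
  case True
  have "f t * exp (- C * t) \<le> f 0 * exp (- C * 0)"
  proof (rule DERIV_nonpos_imp_nonincreasing[OF True])
    fix x
    have "((\<lambda>t. f t * exp (- C * t)) has_real_derivative (f' x - C * f x) * exp (- C * x)) (at x)"
      by (auto intro!: derivative_eq_intros deriv simp: algebra_simps)
    moreover have "(f' x - C * f x) * exp (- C * x) \<le> 0"
      using bound[of x] by (intro mult_nonpos_nonneg) auto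
    ultimately show "\<exists>y. ((\<lambda>t. f t * exp (- C * t)) has_real_derivative y) (at x) \<and> y \<le> 0"
      by blast
  qed
  then show ?thesis
    using zero nonneg[of t] by (simp add: mult_le_0_iff)
next
  case False
  have "f t * exp (C * t) \<le> f 0 * exp (C * 0)"
  proof (rule DERIV_nonneg_imp_nondecreasing[where f = "\<lambda>t. f t * exp (C * t)"])
    fix x
    have "((\<lambda>t. f t * exp (C * t)) has_real_derivative (f' x + C * f x) * exp (C * x)) (at x)"
      by (auto intro!: derivative_eq_intros deriv simp: algebra_simps)
    moreover have "(f' x + C * f x) * exp (C * x) \<ge> 0"
      using bound[of x] by (intro mult_nonneg_nonneg) auto
    ultimately show "\<exists>y. ((\<lambda>t. f t * exp (C * t)) has_real_derivative y) (at x) \<and> y \<ge> 0"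
      by blast
  qed (use False in auto)
  then show ?thesis
    using zero nonneg[of t] by (simp add: mult_le_0_iff)
qed

lemma sphere_component_le:
  assumes "(D, R, I) \<in> S2 \<rho>" "\<rho> \<ge> 0"
  shows "R \<le> \<rho>"
proof (rule power2_le_imp_le)
  have "R\<^sup>2 + (D\<^sup>2 + I\<^sup>2) = \<rho>\<^sup>2" "D\<^sup>2 + I\<^sup>2 \<ge> 0"
    using assms(1) by (auto simp: S2_def)
  then show "R\<^sup>2 \<le> \<rho>\<^sup>2"
    by linarith
qed (fact assms(2))

text \<open>The last conclusion is the conservation law: in the derivative of the squared norm the
  terms with \<open>p1\<close> cancel among themselves, and so do those with
  \<open>p4\<close>.\<close>

lemma solution_components:
  assumes "solution p1 p4 \<rho> X"
  obtains D R I where "X = (\<lambda>t. (D t, R t, I t))"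
    and "\<And>t. (D has_real_derivative 2 * p1 * I t * D t) (at t)"
    and "\<And>t. (R has_real_derivative 2 * p1 * I t * R t - 2 * p4 * \<rho> * I t) (at t)"
    and "\<And>t. (I has_real_derivative
      - 2 * p1 * ((D t)\<^sup>2 + (R t)\<^sup>2) + 2 * p4 * \<rho> * R t) (at t)"
    and "\<And>t. (D t)\<^sup>2 + (R t)\<^sup>2 + (I t)\<^sup>2 = \<rho>\<^sup>2"
proof -
  define D R I
    where DRI: "D = (\<lambda>t. fst (X t))" "R = (\<lambda>t. fst (snd (X t)))" "I = (\<lambda>t. snd (snd (X t)))"
  have X: "X = (\<lambda>t. (D t, R t, I t))"
    by (simp add: DRI)
  have X': "(X has_vector_derivative vfield p1 p4 \<rho> (X t)) (at t)" for t
    using assms by (simp add: solution_def)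
  have snd: "((\<lambda>t. snd (X t)) has_vector_derivative snd (vfield p1 p4 \<rho> (X t))) (at t)" for t
    by (rule bounded_linear.has_vector_derivative[OF bounded_linear_snd X'])
  have D': "(D has_real_derivative 2 * p1 * I t * D t) (at t)" for t
    using bounded_linear.has_vector_derivative[OF bounded_linear_fst X'[of t]]
    by (simp add: has_real_derivative_iff_has_vector_derivative vfield_def DRI case_prod_unfold)
  have R': "(R has_real_derivative 2 * p1 * I t * R t - 2 * p4 * \<rho> * I t) (at t)" for t
    using bounded_linear.has_vector_derivative[OF bounded_linear_fst snd[of t]]
    by (simp add: has_real_derivative_iff_has_vector_derivative vfield_def DRI case_prod_unfold)
  have I': "(I has_real_derivative - 2 * p1 * ((D t)\<^sup>2 + (R t)\<^sup>2) + 2 * p4 * \<rho> * R t) (at t)" for t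
    using bounded_linear.has_vector_derivative[OF bounded_linear_snd snd[of t]]
    by (simp add: has_real_derivative_iff_has_vector_derivative vfield_def DRI case_prod_unfold)
  have "((\<lambda>t. (D t)\<^sup>2 + (R t)\<^sup>2 + (I t)\<^sup>2) has_real_derivative 0) (at t)" for t
    by (rule derivative_eq_intros D' R' I' refl)+ (simp add: algebra_simps power2_eq_square)
  then have "(D t)\<^sup>2 + (R t)\<^sup>2 + (I t)\<^sup>2 = (D 0)\<^sup>2 + (R 0)\<^sup>2 + (I 0)\<^sup>2" for t
    by (rule DERIV_isconst_all[rule_format])
  also have "\<dots> = \<rho>\<^sup>2"
    using assms by (simp add: solution_def X S2_def)
  finally show thesis
    using that X D' R' I' by blast
qed

text \<open>The field is quadratic, hence not globally Lipschitz; boundedness of the components on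
  the sphere supplies the linear estimate for the squared distance \<open>e\<close>.\<close>

lemma solution_unique:
  assumes "p1 \<ge> 0" "\<rho> \<ge> 0"
    and X: "solution p1 p4 \<rho> X" and Y: "solution p1 p4 \<rho> Y" and "X 0 = Y 0"
  shows "X = Y"
proof -
  from X obtain D R I where DRI: "X = (\<lambda>t. (D t, R t, I t))"
    and d1: "\<And>t. (D has_real_derivative 2 * p1 * I t * D t) (at t)"
    "\<And>t. (R has_real_derivative 2 * p1 * I t * R t - 2 * p4 * \<rho> * I t) (at t)"
    "\<And>t. (I has_real_derivative - 2 * p1 * ((D t)\<^sup>2 + (R t)\<^sup>2) + 2 * p4 * \<rho> * R t) (at t)"
    and s1: "\<And>t. (D t)\<^sup>2 + (R t)\<^sup>2 + (I t)\<^sup>2 = \<rho>\<^sup>2"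
    by (rule solution_components) blast
  from Y obtain U V W where UVW: "Y = (\<lambda>t. (U t, V t, W t))"
    and d2: "\<And>t. (U has_real_derivative 2 * p1 * W t * U t) (at t)"
    "\<And>t. (V has_real_derivative 2 * p1 * W t * V t - 2 * p4 * \<rho> * W t) (at t)"
    "\<And>t. (W has_real_derivative - 2 * p1 * ((U t)\<^sup>2 + (V t)\<^sup>2) + 2 * p4 * \<rho> * V t) (at t)"
    by (rule solution_components) blast
  define e where "e t = (D t - U t)\<^sup>2 + (R t - V t)\<^sup>2 + (I t - W t)\<^sup>2" for t
  \<comment> \<open>In \<open>e'\<close> the linear terms with \<open>p4\<close> cancel. What
    remains is arranged so that every product of differences is multiplied by a component of the
    first solution, which is at most \<open>\<rho>\<close> in absolute value.\<close>
  define g where "g t = I t * (D t - U t)\<^sup>2 + I t * (R t - V t)\<^sup>2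
      - (I t - W t) * (D t - U t) * D t - (I t - W t) * (R t - V t) * R t" for t
  have deriv: "(e has_real_derivative 4 * p1 * g t) (at t)" for t
    unfolding e_def g_def
    by (rule derivative_eq_intros d1 d2 refl)+ (simp add: algebra_simps power2_eq_square)
  \<comment> \<open>The constant is \<open>4 * p1\<close> times \<open>2 * \<rho>\<close>. Splitting
    the mixed products by \<open>\<bar>a * b\<bar> \<le> (a\<^sup>2 + b\<^sup>2) / 2\<close> bounds
    \<open>g\<close> by the three squared differences with coefficients
    \<open>3 * \<rho> / 2\<close>, \<open>3 * \<rho> / 2\<close> and \<open>\<rho>\<close>, all
    rounded up to \<open>2 * \<rho>\<close>.\<close>
  have bound: "\<bar>4 * p1 * g t\<bar> \<le> (8 * p1 * \<rho>) * e t" for t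
  proof -
    have le: "\<bar>D t\<bar> \<le> \<rho>" "\<bar>R t\<bar> \<le> \<rho>" "\<bar>I t\<bar> \<le> \<rho>"
      using s1[of t] \<open>\<rho> \<ge> 0\<close> by (auto intro!: power2_le_imp_le[OF _ \<open>\<rho> \<ge> 0\<close>]) (smt (verit) zero_le_power2)+
    have ab: "\<bar>a * b\<bar> \<le> (a\<^sup>2 + b\<^sup>2) / 2" for a b :: real
      using zero_le_power2[of "\<bar>a\<bar> - \<bar>b\<bar>"] by (simp add: power2_diff abs_mult)
    have m: "\<bar>x * z\<bar> \<le> \<rho> * y" if "\<bar>x\<bar> \<le> y" "\<bar>z\<bar> \<le> \<rho>" for x y z :: real
      using mult_mono[OF that] that by (simp add: abs_mult mult.commute)
    have "\<bar>I t * (D t - U t)\<^sup>2\<bar> \<le> \<rho> * (D t - U t)\<^sup>2" "\<bar>I t * (R t - V t)\<^sup>2\<bar> \<le> \<rho> * (R t - V t)\<^sup>2"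
      using le by (auto simp: abs_mult intro: mult_right_mono)
    moreover note m[OF ab[of "I t - W t" "D t - U t"] le(1)] m[OF ab[of "I t - W t" "R t - V t"] le(2)]
    ultimately have "\<bar>g t\<bar>
      \<le> \<rho> * (D t - U t)\<^sup>2 + \<rho> * (R t - V t)\<^sup>2
        + \<rho> * (((I t - W t)\<^sup>2 + (D t - U t)\<^sup>2) / 2) + \<rho> * (((I t - W t)\<^sup>2 + (R t - V t)\<^sup>2) / 2)"
      unfolding g_def by linarith
    also have "\<dots> = \<rho> * (2 * e t) - \<rho> / 2 * (D t - U t)\<^sup>2 - \<rho> / 2 * (R t - V t)\<^sup>2 - \<rho> * (I t - W t)\<^sup>2"
      by (simp add: e_def field_simps)
    also have "\<dots> \<le> \<rho> * (2 * e t)"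
    proof -
      have "\<rho> / 2 * (D t - U t)\<^sup>2 \<ge> 0" "\<rho> / 2 * (R t - V t)\<^sup>2 \<ge> 0" "\<rho> * (I t - W t)\<^sup>2 \<ge> 0"
        using \<open>\<rho> \<ge> 0\<close> by simp_all
      then show ?thesis
        by linarith
    qed
    finally have "4 * p1 * \<bar>g t\<bar> \<le> 4 * p1 * (\<rho> * (2 * e t))"
      using \<open>p1 \<ge> 0\<close> by (intro mult_left_mono) auto
    then show ?thesis
      using \<open>p1 \<ge> 0\<close> by (simp add: abs_mult)
  qed
  have "e t = 0" for t
    by (rule eq_zero_if_deriv_bound[OF deriv bound]) (use \<open>X 0 = Y 0\<close> in \<open>simp_all add: e_def DRI UVW\<close>)
  then have "D t = U t \<and> R t = V t \<and> I t = W t" for t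
    unfolding e_def by (smt (verit) power2_eq_iff_nonneg zero_eq_power2 zero_le_power2)
  then show ?thesis
    by (simp add: DRI UVW)
qed

text \<open>Reduces each equivalence with an explicit formula to a check of that formula: it solves
  the system and has the right value at time 0.\<close>

lemma solution_iff_eq:
  assumes "p1 \<ge> 0" "\<rho> \<ge> 0" "solution p1 p4 \<rho> Y" "Y 0 = q"
  shows "solution p1 p4 \<rho> X \<and> X 0 = q \<longleftrightarrow> (\<forall>t. X t = Y t)"
proof
  assume "solution p1 p4 \<rho> X \<and> X 0 = q"
  then show "\<forall>t. X t = Y t"
    using solution_unique[of p1 \<rho> p4 X Y] assms by simp
next
  assume "\<forall>t. X t = Y t"
  then have "X = Y"
    by blast
  then show "solution p1 p4 \<rho> X \<and> X 0 = q"
    using assms by simp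
qed

text \<open>Passes from non-equilibrium, which concerns the whole trajectory, to the initial point.
  At a fixed point the constant function is a solution, so by uniqueness a trajectory starting there
  never leaves.\<close>

lemma nonequilibrium_initial:
  assumes "p1 \<ge> 0" "\<rho> \<ge> 0" "nonequilibrium_solution p1 p4 \<rho> X"
  shows "solution p1 p4 \<rho> X" "X 0 \<in> S2 \<rho>" "\<not> fixed_point p1 p4 \<rho> (X 0)"
proof -
  show X: "solution p1 p4 \<rho> X"
    using assms by (simp add: nonequilibrium_solution_def)
  show "X 0 \<in> S2 \<rho>"
    using X by (simp add: solution_def)
  show "\<not> fixed_point p1 p4 \<rho> (X 0)"
  proof
    assume fp: "fixed_point p1 p4 \<rho> (X 0)"
    then have "solution p1 p4 \<rho> (\<lambda>_. X 0)"
      by (auto simp: solution_def fixed_point_def zero_prod_def[symmetric])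
    then have "X = (\<lambda>_. X 0)"
      using solution_unique[OF assms(1,2) X] by simp
    then have "\<forall>t. X t = X 0" by metis
    then show False
      using fp assms(3) unfolding nonequilibrium_solution_def by blast
  qed
qed

section \<open>Solutions built from one scalar function\<close>

text \<open>The first two equations hold for every nonvanishing \<open>q\<close>, because
  \<open>1 / q\<close> solves \<open>u' = 2 * p1 * I * u\<close> when
  \<open>I = - q' / (2 * p1 * q)\<close>. Since \<open>p4 = \<kappa> * p1\<close>, the third reads
  \<open>I' = - 2 * p1 * (D\<^sup>2 + R * (R - \<kappa> * \<rho>))\<close>; multiplied by
  \<open>- 2 * p1 * q\<^sup>2\<close> it becomes the hypothesis \<open>id\<close>. The values of
  \<open>q\<close> and \<open>q'\<close> at 0 encode the initial point.\<close>

lemma solution_quotient: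
  fixes p1 p4 \<rho> \<kappa> N :: real
  assumes "p1 \<noteq> 0" "p4 = \<kappa> * p1" "N \<noteq> 0" "(D0, R0, I0) \<in> S2 \<rho>"
    and q0: "q 0 = N" and q'0: "q' 0 = - 2 * p1 * N * I0"
    and nz: "\<And>t. q t \<noteq> 0"
    and q': "\<And>t. (q has_real_derivative q' t) (at t)"
    and q'': "\<And>t. (q' has_real_derivative q'' t) (at t)"
    and id: "\<And>t. q'' t * q t - (q' t)\<^sup>2 =
      4 * p1\<^sup>2 * N * (N * D0\<^sup>2 + (R0 - \<kappa> * \<rho>) * (\<kappa> * \<rho> * q t + N * (R0 - \<kappa> * \<rho>)))"
  defines "Y \<equiv> \<lambda>t. (N * D0 / q t, \<kappa> * \<rho> + N * (R0 - \<kappa> * \<rho>) / q t, - (q' t / (2 * p1 * q t)))"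
  shows "solution p1 p4 \<rho> Y" "Y 0 = (D0, R0, I0)"
proof -
  show Y0: "Y 0 = (D0, R0, I0)"
    using assms(1,3) by (simp add: Y_def q0 q'0)
  have "(Y has_vector_derivative vfield p1 p4 \<rho> (Y t)) (at t)" for t
  proof -
    have 1: "((\<lambda>t. N * D0 / q t) has_real_derivative fst (vfield p1 p4 \<rho> (Y t))) (at t)"
      using nz[of t] \<open>p1 \<noteq> 0\<close>
      by (auto simp: vfield_def Y_def field_simps power2_eq_square intro!: derivative_eq_intros q')
    have 2: "((\<lambda>t. \<kappa> * \<rho> + N * (R0 - \<kappa> * \<rho>) / q t) has_real_derivative
        fst (snd (vfield p1 p4 \<rho> (Y t)))) (at t)"
      using nz[of t] \<open>p1 \<noteq> 0\<close>
      by (auto simp: vfield_def Y_def assms(2) field_simps power2_eq_square intro!: derivative_eq_intros q')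
    have "((\<lambda>t. - (q' t / (2 * p1 * q t))) has_real_derivative
        - ((q'' t * q t - (q' t)\<^sup>2) / (2 * p1 * (q t)\<^sup>2))) (at t)"
      using nz[of t] \<open>p1 \<noteq> 0\<close>
      by (auto simp: field_simps power2_eq_square intro!: derivative_eq_intros q' q'')
    also have "- ((q'' t * q t - (q' t)\<^sup>2) / (2 * p1 * (q t)\<^sup>2)) = snd (snd (vfield p1 p4 \<rho> (Y t)))"
      unfolding id using nz[of t] \<open>p1 \<noteq> 0\<close>
      by (simp add: vfield_def Y_def assms(2) field_simps power2_eq_square)
    finally have 3: "((\<lambda>t. - (q' t / (2 * p1 * q t))) has_real_derivative
       snd (snd (vfield p1 p4 \<rho> (Y t)))) (at t)" .
    show ?thesis
      using has_vector_derivative_Pair[OF 1[unfolded has_real_derivative_iff_has_vector_derivative]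
        has_vector_derivative_Pair[OF 2[unfolded has_real_derivative_iff_has_vector_derivative]
          3[unfolded has_real_derivative_iff_has_vector_derivative]]]
      by (simp add: Y_def)
  qed
  with Y0 show "solution p1 p4 \<rho> Y"
    using assms(4) by (simp add: solution_def)
qed

section \<open>Existence and uniqueness of the phase\<close>

lemma eq_if_square_eq_same_sign:
  fixes x y :: real
  assumes "x\<^sup>2 = y\<^sup>2" "x * y \<ge> 0"
  shows "x = y"
  using assms by (auto simp: power2_eq_iff zero_le_mult_iff)

text \<open>\<open>cosh\<close> determines \<open>t\<close> only up to sign, and the condition on
  \<open>t * s\<close> selects the sign. By \<open>cosh\<^sup>2 - sinh\<^sup>2 = 1\<close> and the
  relation between \<open>L\<close>, \<open>B\<close> and \<open>s\<close>, both conditions together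
  amount to one equation for \<open>sinh\<close>, which is a bijection of the reals. In the converse
  direction \<open>B > 0\<close> selects the positive root.\<close>

lemma cosh_phase_iff:
  fixes L B c s :: real
  assumes "L > 0" "c > 0" "B > 0" "L\<^sup>2 = B\<^sup>2 - c * s\<^sup>2"
  shows "t * s \<ge> 0 \<and> L * cosh t = B \<longleftrightarrow> L * sinh t = sqrt c * s"
proof
  have pyth: "(L * cosh t)\<^sup>2 = L\<^sup>2 + (L * sinh t)\<^sup>2"
    by (simp add: power_mult_distrib cosh_square_eq algebra_simps)
  have c: "(sqrt c * s)\<^sup>2 = c * s\<^sup>2"
    using \<open>c > 0\<close> by (simp add: power_mult_distrib)
  show "L * sinh t = sqrt c * s" if "t * s \<ge> 0 \<and> L * cosh t = B"
  proof (rule eq_if_square_eq_same_sign)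
    show "(L * sinh t)\<^sup>2 = (sqrt c * s)\<^sup>2"
      using that pyth c assms by simp
    show "L * sinh t * (sqrt c * s) \<ge> 0"
      using that assms by (auto simp: zero_le_mult_iff mult_le_0_iff)
  qed
  show "t * s \<ge> 0 \<and> L * cosh t = B" if *: "L * sinh t = sqrt c * s"
  proof
    have "(L * cosh t)\<^sup>2 = B\<^sup>2"
      using pyth c assms * by simp
    then show "L * cosh t = B"
      using assms by (simp add: power2_eq_iff_nonneg)
    have "s = L * sinh t / sqrt c"
      using * \<open>c > 0\<close> by (simp add: field_simps)
    then show "t * s \<ge> 0"
      using assms by
        (auto simp: zero_le_mult_iff mult_le_0_iff zero_le_divide_iff divide_le_0_iff)
  qed
qed

text \<open>Circular counterpart. The equation for \<open>cos\<close> is kept on the right, since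
  \<open>sin\<close> is not injective on the interval; the two equations together name a point of
  the circle.\<close>

lemma cos_phase_iff:
  fixes L B c s :: real
  assumes "L > 0" "c > 0" "L\<^sup>2 = B\<^sup>2 + c * s\<^sup>2" "t \<in> {-pi<..pi}"
  shows "t * s \<ge> 0 \<and> L * cos t = B \<longleftrightarrow> L * sin t = sqrt c * s \<and> L * cos t = B"
proof -
  \<comment> \<open>The open left end matters: at \<open>-pi\<close> the sine would be 0 although
    \<open>t\<close> is negative.\<close>
  have sgn: "sin t \<ge> 0 \<longleftrightarrow> t \<ge> 0"
    using assms(4) sin_ge_zero[of t] sin_gt_zero[of "-t"] by (cases "t < 0") auto
  show ?thesis
  proof (intro iffI conjI; (elim conjE)?)
    assume *: "t * s \<ge> 0" "L * cos t = B"
    show "L * sin t = sqrt c * s"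
    proof (rule eq_if_square_eq_same_sign)
      show "(L * sin t)\<^sup>2 = (sqrt c * s)\<^sup>2"
      proof -
        have "(L * sin t)\<^sup>2 = L\<^sup>2 - (L * cos t)\<^sup>2"
          by (simp add: power_mult_distrib sin_squared_eq algebra_simps)
        also have "\<dots> = (sqrt c * s)\<^sup>2"
          using assms(2,3) *(2) by (simp add: power_mult_distrib)
        finally show ?thesis .
      qed
      have "sin t \<le> 0" if "t \<le> 0"
        using that assms(4) sin_ge_zero[of "-t"] by simp
      then show "L * sin t * (sqrt c * s) \<ge> 0"
        using * sgn assms by (auto simp: zero_le_mult_iff mult_le_0_iff)
    qed
  next
    assume *: "L * sin t = sqrt c * s"
    have "s = L * sin t / sqrt c"
      using * \<open>c > 0\<close> by (simp add: field_simps)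
    then show "t * s \<ge> 0"
      using assms(1,2) sgn by
        (auto simp: zero_le_mult_iff mult_le_0_iff zero_le_divide_iff divide_le_0_iff)
  qed auto
qed

lemma ex1_cosh_phase:
  fixes L B c s :: real
  assumes "L > 0" "c > 0" "B > 0" "L\<^sup>2 = B\<^sup>2 - c * s\<^sup>2"
  shows "\<exists>!t. t * s \<ge> 0 \<and> L * cosh t = B"
proof -
  have "L * sinh t = sqrt c * s \<longleftrightarrow> t = arsinh (sqrt c * s / L)" for t
  proof -
    have "L * sinh t = sqrt c * s \<longleftrightarrow> sinh t = sqrt c * s / L"
      using \<open>L > 0\<close> by (auto simp: field_simps)
    then show ?thesis
      by (metis arsinh_sinh_real sinh_arsinh_real)
  qed
  then show ?thesis
    unfolding cosh_phase_iff[OF assms] by simp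
qed

text \<open>The point \<open>(B / L, sqrt c * s / L)\<close> lies on the unit circle and so has
  exactly one angle in the half-open interval. For \<open>s = 0\<close> and \<open>B < 0\<close>
  this angle is \<open>pi\<close>.\<close>

lemma ex1_cos_phase:
  fixes L B c s :: real
  assumes "L > 0" "c > 0" "L\<^sup>2 = B\<^sup>2 + c * s\<^sup>2"
  shows "\<exists>!t. t \<in> {-pi<..pi} \<and> t * s \<ge> 0 \<and> L * cos t = B"
proof -
  have "(B / L)\<^sup>2 + (sqrt c * s / L)\<^sup>2 = 1"
    using assms by (simp add: power_divide power_mult_distrib flip: add_divide_distrib assms(3))
  then obtain u where u: "B / L = cos u" "sqrt c * s / L = sin u"
    by (rule sincos_total_2pi)
  then obtain v where v: "v \<in> {-pi<..pi}" "B / L = cos v" "sqrt c * s / L = sin v"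
    using sincos_principal_value[of u] by auto
  have "L * sin t = sqrt c * s \<and> L * cos t = B \<longleftrightarrow> sin t = sin v \<and> cos t = cos v" for t
    using v \<open>L > 0\<close> by (auto simp: field_simps)
  moreover have "t = v" if "t \<in> {-pi<..pi}" "sin t = sin v" "cos t = cos v" for t
  proof -
    \<comment> \<open>Halving the difference brings it strictly between \<open>-pi\<close> and
      \<open>pi\<close>, where the only zero of the sine is 0;
      \<open>cos x = 1 - 2 * (sin (x / 2))\<^sup>2\<close> carries \<open>cos (t - v) = 1\<close>
      over.\<close>
    have "sin ((t - v) / 2) = 0"
    proof -
      have "cos (t - v) = 1"
        using that by (simp add: cos_diff flip: power2_eq_square)
      then show ?thesis
        using cos_double_sin[of "(t - v) / 2"] by (simp del: right_diff_distrib_numeral)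
    qed
    then show ?thesis
      using that v(1) sin_eq_0_pi[of "(t - v) / 2"] by auto
  qed
  ultimately have "t \<in> {-pi<..pi} \<and> t * s \<ge> 0 \<and> L * cos t = B \<longleftrightarrow> t = v" for t
    using v(1) cos_phase_iff[OF assms, of t] by blast
  then show ?thesis
    by simp
qed

section \<open>Limits of the explicit formulas\<close>

lemma hyperbolic_limits:
  fixes L a w s :: real
  assumes "L > 0" "w > 0"
  shows "((\<lambda>t. c / (L * cosh (w * t - s) - a)) \<longlongrightarrow> 0) at_top"
    "((\<lambda>t. c / (L * cosh (w * t - s) - a)) \<longlongrightarrow> 0) at_bot"
    "((\<lambda>t. L * sinh (w * t - s) / (L * cosh (w * t - s) - a)) \<longlongrightarrow> 1) at_top"
    "((\<lambda>t. L * sinh (w * t - s) / (L * cosh (w * t - s) - a)) \<longlongrightarrow> -1) at_bot"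
  \<comment> \<open>Written with exponentials, the quotients have asymptotic expansions that
    \<open>real_asymp\<close> can compute.\<close>
  unfolding sinh_def cosh_def real_scaleR_def
  using assms by real_asymp+

lemma rational_limits:
  fixes k :: real
  assumes "k > 0"
  shows "((\<lambda>t. c / ((k * t - i)\<^sup>2 + b)) \<longlongrightarrow> 0) at_top"
    "((\<lambda>t. c / ((k * t - i)\<^sup>2 + b)) \<longlongrightarrow> 0) at_bot"
    "((\<lambda>t. (k * t - i) / ((k * t - i)\<^sup>2 + b)) \<longlongrightarrow> 0) at_top"
    "((\<lambda>t. (k * t - i) / ((k * t - i)\<^sup>2 + b)) \<longlongrightarrow> 0) at_bot"
  using assms by real_asymp+

section \<open>Orbits in the three regimes\<close>

text \<open>Instance of \<open>solution_quotient\<close> with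
  \<open>N = (1 - \<kappa>\<^sup>2) * \<rho>\<close> and the common denominator as \<open>q\<close>.
  Both fixed points have first coordinates \<open>(0, \<kappa> * \<rho>)\<close>, so the hypothesis
  on \<open>(D0, R0)\<close> excludes them together; it is also what makes \<open>\<Lambda>\<close>
  positive.\<close>

lemma hyperbolic_orbit:
  fixes p1 p4 \<rho> \<kappa> :: real
  assumes "p1 > 0" "\<rho> > 0" "0 < \<kappa>" "\<kappa> < 1" "p4 = \<kappa> * p1"
    and sphere: "(D0, R0, I0) \<in> S2 \<rho>"
    and "(D0, R0) \<noteq> (0, \<kappa> * \<rho>)"
  defines "\<Lambda> \<equiv> sqrt ((\<kappa> * \<rho> - R0)\<^sup>2 + (1 - \<kappa>\<^sup>2) * D0\<^sup>2)"
  defines "\<omega> \<equiv> 2 * p1 * \<rho> * sqrt (1 - \<kappa>\<^sup>2)"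
  defines "phase \<equiv> \<lambda>\<tau>0. \<tau>0 * I0 \<ge> 0 \<and>
           ((1 - \<kappa>\<^sup>2) * \<rho>) / (\<Lambda> * cosh \<tau>0 - \<kappa> * (\<kappa> * \<rho> - R0)) = 1"
  defines "Y \<equiv> \<lambda>\<tau>0 \<tau>. (((1 - \<kappa>\<^sup>2) * \<rho> * D0) /
             (\<Lambda> * cosh (\<omega> * \<tau> - \<tau>0) - \<kappa> * (\<kappa> * \<rho> - R0)),
           \<kappa> * \<rho> + ((1 - \<kappa>\<^sup>2) * \<rho> * (R0 - \<kappa> * \<rho>)) /
             (\<Lambda> * cosh (\<omega> * \<tau> - \<tau>0) - \<kappa> * (\<kappa> * \<rho> - R0)),
           - ((\<rho> * sqrt (1 - \<kappa>\<^sup>2) * \<Lambda> * sinh (\<omega> * \<tau> - \<tau>0)) /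
             (\<Lambda> * cosh (\<omega> * \<tau> - \<tau>0) - \<kappa> * (\<kappa> * \<rho> - R0))))"
  shows "\<exists>!\<tau>0. phase \<tau>0"
    and "phase \<tau>0 \<Longrightarrow> solution p1 p4 \<rho> X \<and> X 0 = (D0, R0, I0) \<longleftrightarrow> (\<forall>\<tau>. X \<tau> = Y \<tau>0 \<tau>)"
    and "solution p1 p4 \<rho> X \<Longrightarrow> X 0 = (D0, R0, I0) \<Longrightarrow>
      (X \<longlongrightarrow> (0, \<kappa> * \<rho>, - (\<rho> * sqrt (1 - \<kappa>\<^sup>2)))) at_top \<and>
      (X \<longlongrightarrow> (0, \<kappa> * \<rho>, \<rho> * sqrt (1 - \<kappa>\<^sup>2))) at_bot"
proof -
  define c where "c = 1 - \<kappa>\<^sup>2"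
  define a where "a = \<kappa> * (\<kappa> * \<rho> - R0)"
  \<comment> \<open>The value that the phase condition prescribes for
    \<open>\<Lambda> * cosh \<tau>0\<close>: the denominator must equal \<open>c * \<rho>\<close> at
    time 0, and \<open>c * \<rho> + a = B\<close>.\<close>
  define B where "B = \<rho> - \<kappa> * R0"
  have c: "c > 0"
    using assms(3,4) by (simp add: c_def power_less_one_iff abs_square_less_1)
  have B_eq: "B = c * \<rho> + a"
    by (simp add: B_def a_def c_def algebra_simps power2_eq_square)
  have sph: "D0\<^sup>2 + R0\<^sup>2 + I0\<^sup>2 = \<rho>\<^sup>2"
    using sphere by (simp add: S2_def)
  have pos: "(\<kappa> * \<rho> - R0)\<^sup>2 + c * D0\<^sup>2 > 0"
    using assms(7) c by (cases "D0 = 0") (auto intro: add_nonneg_pos)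
  then have L: "\<Lambda> > 0" "\<Lambda>\<^sup>2 = (\<kappa> * \<rho> - R0)\<^sup>2 + c * D0\<^sup>2"
    by (auto simp: \<Lambda>_def c_def)
  \<comment> \<open>Eliminating \<open>D0\<close> by the sphere equation gives the relation that
    \<open>ex1_cosh_phase\<close> asks for.\<close>
  have L2: "\<Lambda>\<^sup>2 = B\<^sup>2 - c * I0\<^sup>2"
    unfolding L B_def c_def using sph by algebra
  have "R0 \<le> \<rho>"
    using sphere_component_le[OF sphere] \<open>\<rho> > 0\<close> by simp
  then have "\<kappa> * R0 < \<rho>"
    using assms(2-4) mult_left_mono[of R0 \<rho> \<kappa>] mult_strict_right_mono[of \<kappa> 1 \<rho>] by linarith
  then have "B > 0"
    by (simp add: B_def)
  have N: "c * \<rho> > 0"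
    using c \<open>\<rho> > 0\<close> by simp
  have phase: "phase t \<longleftrightarrow> t * I0 \<ge> 0 \<and> \<Lambda> * cosh t = B" for t
    unfolding phase_def B_eq a_def[symmetric] c_def[symmetric] using N by (auto simp: field_simps)
  show ex1: "\<exists>!\<tau>0. phase \<tau>0"
    unfolding phase using ex1_cosh_phase[OF L(1) c \<open>B > 0\<close> L2] .
  define q where "q = (\<lambda>\<tau>0 t. \<Lambda> * cosh (\<omega> * t - \<tau>0) - a)"
  \<comment> \<open>Since \<open>cosh \<ge> 1\<close>, it suffices that
    \<open>a < \<Lambda>\<close>, and this follows from comparing squares.\<close>
  have q_pos: "q \<tau>0 t > 0" for \<tau>0 t
  proof -
    have "\<Lambda>\<^sup>2 - a\<^sup>2 = c * ((\<kappa> * \<rho> - R0)\<^sup>2 + D0\<^sup>2)"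
      unfolding L a_def c_def by algebra
    also have "\<dots> > 0"
      using assms(7) c by (auto simp: sum_power2_gt_zero_iff)
    finally have "a\<^sup>2 < \<Lambda>\<^sup>2"
      by simp
    then have "a < \<Lambda>"
      by (rule power2_less_imp_less) (use L(1) in simp)
    also have "\<dots> \<le> \<Lambda> * cosh (\<omega> * t - \<tau>0)"
      using L(1) by (simp add: cosh_real_ge_1)
    finally show ?thesis
      by (simp add: q_def)
  qed
  have w: "\<omega>\<^sup>2 = 4 * p1\<^sup>2 * \<rho>\<^sup>2 * c" "\<omega> > 0"
    using c assms(1,2) by (auto simp: \<omega>_def c_def power_mult_distrib)
  define q' where "q' = (\<lambda>\<tau>0 t. \<omega> * \<Lambda> * sinh (\<omega> * t - \<tau>0))"
  have Y: "Y \<tau>0 = (\<lambda>t. (c * \<rho> * D0 / q \<tau>0 t, \<kappa> * \<rho> + c * \<rho> * (R0 - \<kappa> * \<rho>) / q \<tau>0 t, - (q' \<tau>0 t / (2 * p1 * q \<tau>0 t))))" for \<tau>0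
    using assms(1) by (auto simp: Y_def q_def q'_def \<omega>_def c_def a_def)
  show sol_iff: "solution p1 p4 \<rho> X \<and> X 0 = (D0, R0, I0) \<longleftrightarrow> (\<forall>\<tau>. X \<tau> = Y \<tau>0 \<tau>)" if ph: "phase \<tau>0" for \<tau>0 X
  proof (rule solution_iff_eq)
    have 0: "\<Lambda> * sinh \<tau>0 = sqrt c * I0" "\<Lambda> * cosh \<tau>0 = B"
      using ph cosh_phase_iff[OF L(1) c \<open>B > 0\<close> L2] by (auto simp: phase)
    have 1: "(q \<tau>0 has_real_derivative q' \<tau>0 t) (at t)" for t
      by (auto simp: q_def q'_def intro!: derivative_eq_intros)
    have 2: "(q' \<tau>0 has_real_derivative \<omega>\<^sup>2 * \<Lambda> * cosh (\<omega> * t - \<tau>0)) (at t)" for t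
      by (auto simp: q'_def power2_eq_square intro!: derivative_eq_intros)
    have 3: "\<omega>\<^sup>2 * \<Lambda> * cosh (\<omega> * t - \<tau>0) * q \<tau>0 t - (q' \<tau>0 t)\<^sup>2 =
        4 * p1\<^sup>2 * (c * \<rho>) * ((c * \<rho>) * D0\<^sup>2 + (R0 - \<kappa> * \<rho>) * (\<kappa> * \<rho> * q \<tau>0 t + (c * \<rho>) * (R0 - \<kappa> * \<rho>)))" for t
    proof -
      \<comment> \<open>Substituting \<open>\<Lambda> * cosh = q + a\<close> leaves an expression
        affine in \<open>q\<close>, as is the required right-hand side; the values of
        \<open>\<Lambda>\<close> and \<open>\<omega>\<close> make the coefficients agree.\<close>
      have "\<omega>\<^sup>2 * \<Lambda> * cosh (\<omega> * t - \<tau>0) * q \<tau>0 t - (q' \<tau>0 t)\<^sup>2 = \<omega>\<^sup>2 * (\<Lambda>\<^sup>2 - a * q \<tau>0 t - a\<^sup>2)"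
        using cosh_square_eq[of "\<omega> * t - \<tau>0"] unfolding q_def q'_def by algebra
      also have "\<dots> = 4 * p1\<^sup>2 * (c * \<rho>) * ((c * \<rho>) * D0\<^sup>2 + (R0 - \<kappa> * \<rho>) * (\<kappa> * \<rho> * q \<tau>0 t + (c * \<rho>) * (R0 - \<kappa> * \<rho>)))"
        unfolding w L a_def c_def by algebra
      finally show ?thesis .
    qed
    \<comment> \<open>The sign condition on \<open>\<tau>0\<close> enters here, through the equation
      for \<open>sinh \<tau>0\<close>; one factor \<open>sqrt c\<close> comes from
      \<open>\<omega>\<close>, the other from that equation.\<close>
    have 4: "q' \<tau>0 0 = - 2 * p1 * (c * \<rho>) * I0"
    proof -
      have "q' \<tau>0 0 = - 2 * p1 * \<rho> * sqrt c * (\<Lambda> * sinh \<tau>0)"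
        by (simp add: q'_def \<omega>_def c_def)
      then show ?thesis
        using c unfolding 0 by (simp add: algebra_simps)
    qed
    have 5: "q \<tau>0 0 = c * \<rho>"
      using 0 B_eq by (simp add: q_def)
    have nz: "q \<tau>0 t \<noteq> 0" "c * \<rho> \<noteq> 0" "p1 \<noteq> 0" for t
      using q_pos[of \<tau>0 t] N assms(1) by auto
    note sol = solution_quotient[OF nz(3) assms(5) nz(2) sphere 5 4 nz(1) 1 2 3]
    show "solution p1 p4 \<rho> (Y \<tau>0)" "Y \<tau>0 0 = (D0, R0, I0)"
      using sol unfolding Y by auto
  qed (use assms in auto)
  show "(X \<longlongrightarrow> (0, \<kappa> * \<rho>, - (\<rho> * sqrt (1 - \<kappa>\<^sup>2)))) at_top \<and>
      (X \<longlongrightarrow> (0, \<kappa> * \<rho>, \<rho> * sqrt (1 - \<kappa>\<^sup>2))) at_bot"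
    if X: "solution p1 p4 \<rho> X" "X 0 = (D0, R0, I0)"
  proof -
    obtain \<tau>0 where "phase \<tau>0"
      using ex1 by blast
    then have "X = Y \<tau>0"
      using sol_iff X by blast
    \<comment> \<open>Regrouped so that the quotients are literally those of
      \<open>hyperbolic_limits\<close>.\<close>
    also have "\<dots> = (\<lambda>t. (c * \<rho> * D0 / (\<Lambda> * cosh (\<omega> * t - \<tau>0) - a),
        \<kappa> * \<rho> + c * \<rho> * (R0 - \<kappa> * \<rho>) / (\<Lambda> * cosh (\<omega> * t - \<tau>0) - a),
        - (\<rho> * sqrt c * (\<Lambda> * sinh (\<omega> * t - \<tau>0) / (\<Lambda> * cosh (\<omega> * t - \<tau>0) - a)))))"
      by (simp add: Y_def c_def a_def mult.assoc)
    finally have X_eq: "X = \<dots>" .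
    note lims = hyperbolic_limits[OF L(1) w(2), where s = \<tau>0 and a = a]
    show ?thesis
      unfolding X_eq c_def[symmetric]
      by (rule conjI lims tendsto_eq_intros refl | simp)+
  qed
qed

text \<open>Same scheme with \<open>N = (\<kappa>\<^sup>2 - 1) * \<rho>\<close> and a cosine in
  \<open>q\<close>. The hypothesis on \<open>(R0, I0)\<close> excludes both fixed points, which
  differ only in the sign of the first coordinate.\<close>

lemma elliptic_orbit:
  fixes p1 p4 \<rho> \<kappa> :: real
  assumes "p1 > 0" "\<rho> > 0" "\<kappa> > 1" "p4 = \<kappa> * p1"
    and sphere: "(D0, R0, I0) \<in> S2 \<rho>"
    and nonfixed: "(R0, I0) \<noteq> (inverse \<kappa> * \<rho>, 0)"
  defines "\<Lambda> \<equiv> sqrt ((\<kappa> * \<rho> - R0)\<^sup>2 - (\<kappa>\<^sup>2 - 1) * D0\<^sup>2)"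
  defines "\<omega> \<equiv> 2 * p1 * \<rho> * sqrt (\<kappa>\<^sup>2 - 1)"
  defines "phase \<equiv> \<lambda>\<tau>0. \<tau>0 \<in> {-pi<..pi} \<and> \<tau>0 * I0 \<ge> 0 \<and>
           ((\<kappa>\<^sup>2 - 1) * \<rho>) / (\<kappa> * (\<kappa> * \<rho> - R0) - \<Lambda> * cos \<tau>0) = 1"
  defines "Y \<equiv> \<lambda>\<tau>0 \<tau>. (((\<kappa>\<^sup>2 - 1) * \<rho> * D0) /
             (\<kappa> * (\<kappa> * \<rho> - R0) - \<Lambda> * cos (\<omega> * \<tau> - \<tau>0)),
           \<kappa> * \<rho> + ((\<kappa>\<^sup>2 - 1) * \<rho> * (R0 - \<kappa> * \<rho>)) /
             (\<kappa> * (\<kappa> * \<rho> - R0) - \<Lambda> * cos (\<omega> * \<tau> - \<tau>0)),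
           - ((\<rho> * sqrt (\<kappa>\<^sup>2 - 1) * \<Lambda> * sin (\<omega> * \<tau> - \<tau>0)) /
             (\<kappa> * (\<kappa> * \<rho> - R0) - \<Lambda> * cos (\<omega> * \<tau> - \<tau>0))))"
  shows "\<exists>!\<tau>0. phase \<tau>0"
    and "phase \<tau>0 \<Longrightarrow> solution p1 p4 \<rho> X \<and> X 0 = (D0, R0, I0) \<longleftrightarrow> (\<forall>\<tau>. X \<tau> = Y \<tau>0 \<tau>)"
    and "solution p1 p4 \<rho> X \<Longrightarrow> X 0 = (D0, R0, I0) \<Longrightarrow> \<exists>T>0. periodic_fun_simple X T"
proof -
  define c where "c = \<kappa>\<^sup>2 - 1"
  define a where "a = \<kappa> * (\<kappa> * \<rho> - R0)"
  define B where "B = \<rho> - \<kappa> * R0"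
  have c: "c > 0"
    using assms(3) by (simp add: c_def)
  have B_eq: "B = a - c * \<rho>"
    by (simp add: B_def a_def c_def algebra_simps power2_eq_square)
  have sph: "D0\<^sup>2 + R0\<^sup>2 + I0\<^sup>2 = \<rho>\<^sup>2"
    using sphere by (simp add: S2_def)
  \<comment> \<open>A difference under the root in \<open>\<Lambda>\<close> becomes a sum of
    nonnegative terms by the sphere equation. The sum vanishes only for \<open>I0 = 0\<close> and
    \<open>R0 = inverse \<kappa> * \<rho>\<close>, that is, at the fixed points.\<close>
  have quad: "(\<kappa> * \<rho> - R0)\<^sup>2 - c * D0\<^sup>2 = B\<^sup>2 + c * I0\<^sup>2"
    unfolding B_def c_def using sph by algebra
  have "B\<^sup>2 + c * I0\<^sup>2 > 0"
  proof (cases "I0 = 0")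
    case True
    then have "B \<noteq> 0"
      using nonfixed assms(3) by (auto simp: B_def field_simps)
    then show ?thesis
      using True by simp
  qed (use c in \<open>auto intro: add_nonneg_pos\<close>)
  then have L: "\<Lambda> > 0" "\<Lambda>\<^sup>2 = (\<kappa> * \<rho> - R0)\<^sup>2 - c * D0\<^sup>2"
    by (auto simp: \<Lambda>_def c_def[symmetric] quad)
  have L2: "\<Lambda>\<^sup>2 = B\<^sup>2 + c * I0\<^sup>2"
    by (simp add: L quad)
  have "R0 \<le> \<rho>"
    using sphere_component_le[OF sphere] \<open>\<rho> > 0\<close> by simp
  then have R0: "R0 < \<kappa> * \<rho>"
    using assms(2,3) mult_strict_right_mono[of 1 \<kappa> \<rho>] by linarith
  have N: "c * \<rho> > 0"
    using c \<open>\<rho> > 0\<close> by simp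
  have phase: "phase t \<longleftrightarrow> t \<in> {-pi<..pi} \<and> t * I0 \<ge> 0 \<and> \<Lambda> * cos t = B" for t
    unfolding phase_def B_eq a_def[symmetric] c_def[symmetric] using N by (auto simp: field_simps)
  show ex1: "\<exists>!\<tau>0. phase \<tau>0"
    unfolding phase using ex1_cos_phase[OF L(1) c L2] .
  define q where "q = (\<lambda>\<tau>0 t. a - \<Lambda> * cos (\<omega> * t - \<tau>0))"
  \<comment> \<open>The chain is \<open>\<Lambda> \<le> \<kappa> * \<rho> - R0 < \<kappa> *
    (\<kappa> * \<rho> - R0) = a\<close>, where
    \<open>R0 \<le> \<rho> < \<kappa> * \<rho>\<close>.\<close>
  have q_pos: "q \<tau>0 t > 0" for \<tau>0 t
  proof -
    have "\<Lambda> * cos (\<omega> * t - \<tau>0) \<le> \<Lambda>"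
      using L(1) by simp
    also have "\<Lambda> \<le> \<kappa> * \<rho> - R0"
      by (rule power2_le_imp_le) (use R0 c in \<open>auto simp: L\<close>)
    also have "\<dots> < a"
      using R0 assms(3) by (simp add: a_def)
    finally show ?thesis
      by (simp add: q_def)
  qed
  have w: "\<omega>\<^sup>2 = 4 * p1\<^sup>2 * \<rho>\<^sup>2 * c" "\<omega> > 0"
    using c assms(1,2) by (auto simp: \<omega>_def c_def power_mult_distrib)
  define q' where "q' = (\<lambda>\<tau>0 t. \<omega> * \<Lambda> * sin (\<omega> * t - \<tau>0))"
  have Y: "Y \<tau>0 = (\<lambda>t. (c * \<rho> * D0 / q \<tau>0 t, \<kappa> * \<rho> + c * \<rho> * (R0 - \<kappa> * \<rho>) / q \<tau>0 t, - (q' \<tau>0 t / (2 * p1 * q \<tau>0 t))))" for \<tau>0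
    using assms(1) by (auto simp: Y_def q_def q'_def \<omega>_def c_def a_def)
  show sol_iff: "solution p1 p4 \<rho> X \<and> X 0 = (D0, R0, I0) \<longleftrightarrow> (\<forall>\<tau>. X \<tau> = Y \<tau>0 \<tau>)" if ph: "phase \<tau>0" for \<tau>0 X
  proof (rule solution_iff_eq)
    have 0: "\<Lambda> * sin \<tau>0 = sqrt c * I0" "\<Lambda> * cos \<tau>0 = B"
      using ph cos_phase_iff[OF L(1) c L2] by (auto simp: phase)
    have 1: "(q \<tau>0 has_real_derivative q' \<tau>0 t) (at t)" for t
      by (auto simp: q_def q'_def intro!: derivative_eq_intros)
    have 2: "(q' \<tau>0 has_real_derivative \<omega>\<^sup>2 * \<Lambda> * cos (\<omega> * t - \<tau>0)) (at t)" for t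
      by (auto simp: q'_def power2_eq_square intro!: derivative_eq_intros)
    have 3: "\<omega>\<^sup>2 * \<Lambda> * cos (\<omega> * t - \<tau>0) * q \<tau>0 t - (q' \<tau>0 t)\<^sup>2 =
        4 * p1\<^sup>2 * (c * \<rho>) * ((c * \<rho>) * D0\<^sup>2 + (R0 - \<kappa> * \<rho>) * (\<kappa> * \<rho> * q \<tau>0 t + (c * \<rho>) * (R0 - \<kappa> * \<rho>)))" for t
    proof -
      have "\<omega>\<^sup>2 * \<Lambda> * cos (\<omega> * t - \<tau>0) * q \<tau>0 t - (q' \<tau>0 t)\<^sup>2 = \<omega>\<^sup>2 * (a\<^sup>2 - a * q \<tau>0 t - \<Lambda>\<^sup>2)"
        using sin_cos_squared_add[of "\<omega> * t - \<tau>0"] unfolding q_def q'_def by algebra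
      also have "\<dots> = 4 * p1\<^sup>2 * (c * \<rho>) * ((c * \<rho>) * D0\<^sup>2 + (R0 - \<kappa> * \<rho>) * (\<kappa> * \<rho> * q \<tau>0 t + (c * \<rho>) * (R0 - \<kappa> * \<rho>)))"
        unfolding w L a_def c_def by algebra
      finally show ?thesis .
    qed
    have 4: "q' \<tau>0 0 = - 2 * p1 * (c * \<rho>) * I0"
    proof -
      have "q' \<tau>0 0 = - 2 * p1 * \<rho> * sqrt c * (\<Lambda> * sin \<tau>0)"
        by (simp add: q'_def \<omega>_def c_def)
      then show ?thesis
        using c unfolding 0 by (simp add: algebra_simps)
    qed
    have 5: "q \<tau>0 0 = c * \<rho>"
      using 0 B_eq by (simp add: q_def)
    have nz: "q \<tau>0 t \<noteq> 0" "c * \<rho> \<noteq> 0" "p1 \<noteq> 0" for t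
      using q_pos[of \<tau>0 t] N assms(1) by auto
    note sol = solution_quotient[OF nz(3) assms(4) nz(2) sphere 5 4 nz(1) 1 2 3]
    show "solution p1 p4 \<rho> (Y \<tau>0)" "Y \<tau>0 0 = (D0, R0, I0)"
      using sol unfolding Y by auto
  qed (use assms in auto)
  show "\<exists>T>0. periodic_fun_simple X T" if X: "solution p1 p4 \<rho> X" "X 0 = (D0, R0, I0)"
  proof (intro exI conjI)
    obtain \<tau>0 where "phase \<tau>0"
      using ex1 by blast
    then have X_eq: "X = Y \<tau>0"
      using sol_iff X by blast
    have "\<omega> * (t + 2 * pi / \<omega>) - \<tau>0 = (\<omega> * t - \<tau>0) + 2 * pi" for t
      using w(2) by (simp add: field_simps)
    then show "periodic_fun_simple X (2 * pi / \<omega>)"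
      unfolding X_eq by unfold_locales (simp only: Y_def sin_periodic cos_periodic)
    show "2 * pi / \<omega> > 0"
      using w(2) by simp
  qed
qed

text \<open>Case \<open>\<kappa> = 1\<close>, with \<open>N = G\<close> and a quadratic
  \<open>q\<close>. No phase has to be found, as \<open>q 0 = G\<close> and
  \<open>q' 0 = - 2 * p1 * G * I0\<close> hold directly.\<close>

lemma parabolic_orbit:
  fixes p1 p4 \<rho> :: real
  assumes "p1 > 0" "\<rho> > 0" "p4 = p1"
    and sphere: "(D0, R0, I0) \<in> S2 \<rho>" and "(D0, R0, I0) \<noteq> (0, \<rho>, 0)"
  defines "G \<equiv> 2 * \<rho> * (\<rho> - R0)"
  defines "Y \<equiv> \<lambda>\<tau>. ((G * D0) / ((p1 * G * \<tau> - I0)\<^sup>2 + G - I0\<^sup>2),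
      \<rho> - (2 * \<rho> * (\<rho> - R0)\<^sup>2) / ((p1 * G * \<tau> - I0)\<^sup>2 + G - I0\<^sup>2),
      - ((G * (p1 * G * \<tau> - I0)) / ((p1 * G * \<tau> - I0)\<^sup>2 + G - I0\<^sup>2)))"
  shows "solution p1 p4 \<rho> X \<and> X 0 = (D0, R0, I0) \<longleftrightarrow> (\<forall>\<tau>. X \<tau> = Y \<tau>)"
    and "solution p1 p4 \<rho> X \<Longrightarrow> X 0 = (D0, R0, I0) \<Longrightarrow>
      (X \<longlongrightarrow> (0, \<rho>, 0)) at_top \<and> (X \<longlongrightarrow> (0, \<rho>, 0)) at_bot"
proof -
  have sph: "D0\<^sup>2 + R0\<^sup>2 + I0\<^sup>2 = \<rho>\<^sup>2"
    using sphere by (simp add: S2_def)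
  have "R0 \<le> \<rho>"
    using sphere_component_le[OF sphere] \<open>\<rho> > 0\<close> by simp
  moreover have "R0 \<noteq> \<rho>"
    using sph assms(5) by (auto simp: add_nonneg_eq_0_iff)
  ultimately have R0: "R0 < \<rho>"
    by simp
  then have G: "G > 0"
    using \<open>\<rho> > 0\<close> by (simp add: G_def)
  define q where "q = (\<lambda>t. (p1 * G * t - I0)\<^sup>2 + G - I0\<^sup>2)"
  define q' where "q' = (\<lambda>t. 2 * p1 * G * (p1 * G * t - I0))"
  \<comment> \<open>The constant term of \<open>q\<close> is a sum of squares on the sphere,
    positive because \<open>R0 < \<rho>\<close>; so the denominator never vanishes.\<close>
  have GI: "G - I0\<^sup>2 = (\<rho> - R0)\<^sup>2 + D0\<^sup>2"
    unfolding G_def using sph by algebra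
  then have q_pos: "q t > 0" for t
  proof -
    have "0 < (p1 * G * t - I0)\<^sup>2 + ((\<rho> - R0)\<^sup>2 + D0\<^sup>2)"
      using R0 by (intro add_nonneg_pos add_pos_nonneg) auto
    then show ?thesis
      using GI by (simp add: q_def)
  qed
  \<comment> \<open>The factor \<open>1\<close> stands for \<open>\<kappa>\<close>, so that the
    shape of \<open>solution_quotient\<close> is matched literally.\<close>
  have Y: "Y = (\<lambda>t. (G * D0 / q t, 1 * \<rho> + G * (R0 - 1 * \<rho>) / q t, - (q' t / (2 * p1 * q t))))"
  proof
    have "2 * \<rho> * (\<rho> - R0)\<^sup>2 = - (G * (R0 - 1 * \<rho>))"
      by (simp add: G_def power2_eq_square algebra_simps)
    then show "Y t = (G * D0 / q t, 1 * \<rho> + G * (R0 - 1 * \<rho>) / q t, - (q' t / (2 * p1 * q t)))" for t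
      using \<open>p1 > 0\<close> by (simp add: Y_def q_def q'_def)
  qed
  show sol_iff: "solution p1 p4 \<rho> X \<and> X 0 = (D0, R0, I0) \<longleftrightarrow> (\<forall>\<tau>. X \<tau> = Y \<tau>)" for X
  proof (rule solution_iff_eq)
    have 1: "(q has_real_derivative q' t) (at t)" for t
      by (auto simp: q_def q'_def intro!: derivative_eq_intros)
    have 2: "(q' has_real_derivative 2 * p1\<^sup>2 * G\<^sup>2) (at t)" for t
      by (auto simp: q'_def power2_eq_square intro!: derivative_eq_intros)
    have 3: "2 * p1\<^sup>2 * G\<^sup>2 * q t - (q' t)\<^sup>2 =
        4 * p1\<^sup>2 * G * (G * D0\<^sup>2 + (R0 - 1 * \<rho>) * (1 * \<rho> * q t + G * (R0 - 1 * \<rho>)))" for t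
      using sph unfolding q_def q'_def G_def by algebra
    have 4: "q' 0 = - 2 * p1 * G * I0" "q 0 = G"
      by (auto simp: q'_def q_def)
    have nz: "q t \<noteq> 0" "G \<noteq> 0" "p1 \<noteq> 0" "p4 = 1 * p1" for t
      using q_pos[of t] G assms(1,3) by auto
    note sol = solution_quotient[OF nz(3,4) nz(2) sphere 4(2,1) nz(1) 1 2 3]
    show "solution p1 p4 \<rho> Y" "Y 0 = (D0, R0, I0)"
      using sol unfolding Y by auto
  qed (use assms in auto)
  have pG: "p1 * G > 0"
    using \<open>p1 > 0\<close> G by simp
  note lims = rational_limits[OF pG, where i = I0 and b = "G - I0\<^sup>2"]
  have Y': "Y = (\<lambda>t. ((G * D0) / ((p1 * G * t - I0)\<^sup>2 + (G - I0\<^sup>2)),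
      \<rho> - (2 * \<rho> * (\<rho> - R0)\<^sup>2) / ((p1 * G * t - I0)\<^sup>2 + (G - I0\<^sup>2)),
      - (G * ((p1 * G * t - I0) / ((p1 * G * t - I0)\<^sup>2 + (G - I0\<^sup>2))))))"
    by (simp add: Y_def add_diff_eq)
  show "(X \<longlongrightarrow> (0, \<rho>, 0)) at_top \<and> (X \<longlongrightarrow> (0, \<rho>, 0)) at_bot"
    if "solution p1 p4 \<rho> X" "X 0 = (D0, R0, I0)"
  proof -
    have X_eq: "X = Y"
      using sol_iff that by blast
    show ?thesis
      unfolding X_eq Y' by (rule conjI lims tendsto_eq_intros refl | simp)+
  qed
qed

section \<open>Fixed points and assembly of the three regimes\<close>

theorem proposition2p10:
  fixes p1 p4 \<rho> \<kappa> :: real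
  assumes "p1 > 0" and "p4 > 0" and "\<rho> > 0"
    and "\<kappa> = p4 / p1"
  shows
    "(p1 > p4 \<longrightarrow>
        fixed_point p1 p4 \<rho> (0, \<kappa> * \<rho>, \<rho> * sqrt (1 - \<kappa>\<^sup>2)) \<and>
        fixed_point p1 p4 \<rho> (0, \<kappa> * \<rho>, - (\<rho> * sqrt (1 - \<kappa>\<^sup>2))) \<and>
        (\<forall>D0 R0 I0.
           (D0, R0, I0) \<in> S2 \<rho> \<and>
           (D0, R0, I0) \<notin> {(0, \<kappa> * \<rho>, \<rho> * sqrt (1 - \<kappa>\<^sup>2)),
                            (0, \<kappa> * \<rho>, - (\<rho> * sqrt (1 - \<kappa>\<^sup>2)))} \<longrightarrow>
           (let \<Lambda> = sqrt ((\<kappa> * \<rho> - R0)\<^sup>2 + (1 - \<kappa>\<^sup>2) * D0\<^sup>2);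
                \<omega> = 2 * p1 * \<rho> * sqrt (1 - \<kappa>\<^sup>2);
                phase = (\<lambda>\<tau>0::real. \<tau>0 * I0 \<ge> 0 \<and>
                  ((1 - \<kappa>\<^sup>2) * \<rho>) / (\<Lambda> * cosh \<tau>0 - \<kappa> * (\<kappa> * \<rho> - R0)) = 1)
            in (\<exists>!\<tau>0. phase \<tau>0) \<and>
               (\<forall>\<tau>0 X. phase \<tau>0 \<longrightarrow>
                  (solution p1 p4 \<rho> X \<and> X 0 = (D0, R0, I0) \<longleftrightarrow>
                   (\<forall>\<tau>. X \<tau> =
                     (((1 - \<kappa>\<^sup>2) * \<rho> * D0) /
                        (\<Lambda> * cosh (\<omega> * \<tau> - \<tau>0) - \<kappa> * (\<kappa> * \<rho> - R0)),
                      \<kappa> * \<rho> + ((1 - \<kappa>\<^sup>2) * \<rho> * (R0 - \<kappa> * \<rho>)) /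
                        (\<Lambda> * cosh (\<omega> * \<tau> - \<tau>0) - \<kappa> * (\<kappa> * \<rho> - R0)),
                      - ((\<rho> * sqrt (1 - \<kappa>\<^sup>2) * \<Lambda> * sinh (\<omega> * \<tau> - \<tau>0)) /
                        (\<Lambda> * cosh (\<omega> * \<tau> - \<tau>0) - \<kappa> * (\<kappa> * \<rho> - R0))))))))) \<and>
        (\<forall>X. nonequilibrium_solution p1 p4 \<rho> X \<longrightarrow>
           (X \<longlongrightarrow> (0, \<kappa> * \<rho>, - (\<rho> * sqrt (1 - \<kappa>\<^sup>2)))) at_top \<and>
           (X \<longlongrightarrow> (0, \<kappa> * \<rho>, \<rho> * sqrt (1 - \<kappa>\<^sup>2))) at_bot))
     \<and>
     (p1 = p4 \<longrightarrow>
        (\<forall>q. fixed_point p1 p4 \<rho> q \<longleftrightarrow> q = (0, \<rho>, 0)) \<and>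
        (\<forall>D0 R0 I0.
           (D0, R0, I0) \<in> S2 \<rho> \<and> (D0, R0, I0) \<noteq> (0, \<rho>, 0) \<longrightarrow>
           (let G = 2 * \<rho> * (\<rho> - R0)
            in (\<forall>X. solution p1 p4 \<rho> X \<and> X 0 = (D0, R0, I0) \<longleftrightarrow>
                  (\<forall>\<tau>. X \<tau> =
                    ((G * D0) / ((p1 * G * \<tau> - I0)\<^sup>2 + G - I0\<^sup>2),
                     \<rho> - (2 * \<rho> * (\<rho> - R0)\<^sup>2) / ((p1 * G * \<tau> - I0)\<^sup>2 + G - I0\<^sup>2),
                     - ((G * (p1 * G * \<tau> - I0)) / ((p1 * G * \<tau> - I0)\<^sup>2 + G - I0\<^sup>2))))))) \<and>
        (\<forall>X. solution p1 p4 \<rho> X \<longrightarrow>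
           (X \<longlongrightarrow> (0, \<rho>, 0)) at_top \<and> (X \<longlongrightarrow> (0, \<rho>, 0)) at_bot))
     \<and>
     (p1 < p4 \<longrightarrow>
        fixed_point p1 p4 \<rho> (\<rho> * sqrt (1 - (inverse \<kappa>)\<^sup>2), inverse \<kappa> * \<rho>, 0) \<and>
        fixed_point p1 p4 \<rho> (- (\<rho> * sqrt (1 - (inverse \<kappa>)\<^sup>2)), inverse \<kappa> * \<rho>, 0) \<and>
        (\<forall>D0 R0 I0.
           (D0, R0, I0) \<in> S2 \<rho> \<and>
           (D0, R0, I0) \<notin> {(\<rho> * sqrt (1 - (inverse \<kappa>)\<^sup>2), inverse \<kappa> * \<rho>, 0),
                            (- (\<rho> * sqrt (1 - (inverse \<kappa>)\<^sup>2)), inverse \<kappa> * \<rho>, 0)} \<longrightarrow>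
           (let \<Lambda> = sqrt ((\<kappa> * \<rho> - R0)\<^sup>2 - (\<kappa>\<^sup>2 - 1) * D0\<^sup>2);
                \<omega> = 2 * p1 * \<rho> * sqrt (\<kappa>\<^sup>2 - 1);
                phase = (\<lambda>\<tau>0. \<tau>0 \<in> {-pi<..pi} \<and> \<tau>0 * I0 \<ge> 0 \<and>
                  ((\<kappa>\<^sup>2 - 1) * \<rho>) / (\<kappa> * (\<kappa> * \<rho> - R0) - \<Lambda> * cos \<tau>0) = 1)
            in (\<exists>!\<tau>0. phase \<tau>0) \<and>
               (\<forall>\<tau>0 X. phase \<tau>0 \<longrightarrow>
                  (solution p1 p4 \<rho> X \<and> X 0 = (D0, R0, I0) \<longleftrightarrow>
                   (\<forall>\<tau>. X \<tau> =
                     (((\<kappa>\<^sup>2 - 1) * \<rho> * D0) /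
                        (\<kappa> * (\<kappa> * \<rho> - R0) - \<Lambda> * cos (\<omega> * \<tau> - \<tau>0)),
                      \<kappa> * \<rho> + ((\<kappa>\<^sup>2 - 1) * \<rho> * (R0 - \<kappa> * \<rho>)) /
                        (\<kappa> * (\<kappa> * \<rho> - R0) - \<Lambda> * cos (\<omega> * \<tau> - \<tau>0)),
                      - ((\<rho> * sqrt (\<kappa>\<^sup>2 - 1) * \<Lambda> * sin (\<omega> * \<tau> - \<tau>0)) /
                        (\<kappa> * (\<kappa> * \<rho> - R0) - \<Lambda> * cos (\<omega> * \<tau> - \<tau>0))))))))) \<and>
        (\<forall>X. nonequilibrium_solution p1 p4 \<rho> X \<longrightarrow>
           (\<exists>T>0. periodic_fun_simple X T)))"
    (is "(_ \<longrightarrow> ?F1 \<and> ?F2 \<and> ?O1 \<and> ?L1) \<and>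
        (_ \<longrightarrow> ?F3 \<and> ?O2 \<and> ?L2) \<and>
        (_ \<longrightarrow> ?F4 \<and> ?F5 \<and> ?O3 \<and> ?L3)")
proof -
  have p4: "p4 = \<kappa> * p1" and \<kappa>: "\<kappa> > 0"
    using assms by auto
  \<comment> \<open>With \<open>p4 = \<kappa> * p1\<close> each component of the field carries the
    factor \<open>2 * p1\<close>. Either \<open>I = 0\<close>, and the point lies on two circles in
    the \<open>(D, R)\<close> plane, or \<open>D = 0\<close> and
    \<open>R = \<kappa> * \<rho>\<close>.\<close>
  have fixed_iff: "fixed_point p1 p4 \<rho> (D, R, I) \<longleftrightarrow>
      D\<^sup>2 + R\<^sup>2 + I\<^sup>2 = \<rho>\<^sup>2 \<and> (I = 0 \<or> D = 0) \<and> (I = 0 \<or> R = \<kappa> * \<rho>) \<and> D\<^sup>2 + R\<^sup>2 = \<kappa> * \<rho> * R" for D R I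
  proof -
    have "2 * p1 * I * R - 2 * p4 * \<rho> * I = 2 * p1 * (I * (R - \<kappa> * \<rho>))"
      "- 2 * p1 * (D\<^sup>2 + R\<^sup>2) + 2 * p4 * \<rho> * R = 2 * p1 * (\<kappa> * \<rho> * R - (D\<^sup>2 + R\<^sup>2))"
      by (simp_all add: p4 algebra_simps)
    then have "vfield p1 p4 \<rho> (D, R, I) =
        (2 * p1 * I * D, 2 * p1 * (I * (R - \<kappa> * \<rho>)), 2 * p1 * (\<kappa> * \<rho> * R - (D\<^sup>2 + R\<^sup>2)))"
      by (simp add: vfield_def)
    then show ?thesis
      using \<open>p1 > 0\<close> by (auto simp: fixed_point_def S2_def)
  qed
  have initial: thesis
    if "nonequilibrium_solution p1 p4 \<rho> X"
      "\<And>D0 R0 I0. \<lbrakk>solution p1 p4 \<rho> X; X 0 = (D0, R0, I0); (D0, R0, I0) \<in> S2 \<rho>;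
        \<not> fixed_point p1 p4 \<rho> (D0, R0, I0)\<rbrakk> \<Longrightarrow> thesis" for X thesis
    using nonequilibrium_initial[OF _ _ that(1)] that(2) assms(1,3)
    by (metis less_imp_le prod_cases3)
  have hyperbolic: ?F1 ?F2 ?O1 ?L1 if "p1 > p4"
  proof -
    have k: "\<kappa> < 1"
      using assms that by simp
    then have k2: "\<kappa>\<^sup>2 \<le> 1"
      using \<kappa> by (simp add: power_le_one)
    show fp: ?F1 ?F2
      using k2 by (auto simp: fixed_iff power_mult_distrib algebra_simps power2_eq_square)
    \<comment> \<open>On the sphere the first two coordinates determine \<open>I0\<close> up to
      sign, so avoiding both fixed points means avoiding their common projection.\<close>
    have nf: "(D0, R0) \<noteq> (0, \<kappa> * \<rho>)"
      if "(D0, R0, I0) \<in> S2 \<rho>"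
        "(D0, R0, I0) \<notin> {(0, \<kappa> * \<rho>, \<rho> * sqrt (1 - \<kappa>\<^sup>2)), (0, \<kappa> * \<rho>, - (\<rho> * sqrt (1 - \<kappa>\<^sup>2)))}"
      for D0 R0 I0
    proof
      assume *: "(D0, R0) = (0, \<kappa> * \<rho>)"
      with that(1) have "I0\<^sup>2 = \<rho>\<^sup>2 - (\<kappa> * \<rho>)\<^sup>2"
        by (auto simp: S2_def)
      also have "\<dots> = (\<rho> * sqrt (1 - \<kappa>\<^sup>2))\<^sup>2"
        using k2 by (simp add: power_mult_distrib algebra_simps)
      finally show False
        using that(2) * by (auto simp: power2_eq_iff)
    qed
    note orbit = hyperbolic_orbit[OF assms(1,3) \<kappa> k p4 _ nf]
    show ?O1
      unfolding Let_def by (intro allI impI, elim conjE, intro conjI allI impI)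
        (rule orbit(1,2); assumption)+
    show ?L1
    proof (intro allI impI)
      fix X assume "nonequilibrium_solution p1 p4 \<rho> X"
      then obtain D0 R0 I0 where X: "solution p1 p4 \<rho> X" "X 0 = (D0, R0, I0)"
        "(D0, R0, I0) \<in> S2 \<rho>" "\<not> fixed_point p1 p4 \<rho> (D0, R0, I0)"
        by (rule initial)
      then show "(X \<longlongrightarrow> (0, \<kappa> * \<rho>, - (\<rho> * sqrt (1 - \<kappa>\<^sup>2)))) at_top \<and>
           (X \<longlongrightarrow> (0, \<kappa> * \<rho>, \<rho> * sqrt (1 - \<kappa>\<^sup>2))) at_bot"
        \<comment> \<open>\<open>X(3)\<close> occurs twice, for the orbit lemma and for
          \<open>nf\<close>. By \<open>fp\<close>, an initial point that is not fixed differs from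
          both listed points.\<close>
        using fp by (intro orbit(3)[OF X(3,3) _ X(1,2)]) auto
    qed
  qed
  have parabolic: ?F3 ?O2 ?L2 if "p1 = p4"
  proof -
    have k: "\<kappa> = 1"
      using assms that by simp
    show fp: ?F3
    proof (intro allI)
      fix q :: "real \<times> real \<times> real"
      obtain D R I where q: "q = (D, R, I)"
        by (rule prod_cases3)
      have "R = \<rho>" if "D\<^sup>2 + R\<^sup>2 = \<rho>\<^sup>2" "D\<^sup>2 + R\<^sup>2 = \<rho> * R"
        using that \<open>\<rho> > 0\<close> by (auto simp: power2_eq_square)
      then show "fixed_point p1 p4 \<rho> q \<longleftrightarrow> q = (0, \<rho>, 0)"
        using \<open>\<rho> > 0\<close> by (auto simp: q fixed_iff k power2_eq_square)
    qed
    note orbit = parabolic_orbit[OF assms(1,3) that[symmetric]]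
    show ?O2
      unfolding Let_def by (intro allI impI, elim conjE) (rule orbit(1); assumption)
    show ?L2
    proof (intro allI impI)
      fix X assume X: "solution p1 p4 \<rho> X"
      obtain D0 R0 I0 where X0: "X 0 = (D0, R0, I0)"
        by (rule prod_cases3)
      have S: "(D0, R0, I0) \<in> S2 \<rho>"
        using X X0 by (simp add: solution_def)
      show "(X \<longlongrightarrow> (0, \<rho>, 0)) at_top \<and> (X \<longlongrightarrow> (0, \<rho>, 0)) at_bot"
      \<comment> \<open>Here the limit is claimed for every solution, so the equilibrium is treated
        too: it is constant at the only fixed point.\<close>
      proof (cases "nonequilibrium_solution p1 p4 \<rho> X")
        case True
        then show ?thesis
          using orbit(2)[OF S] X X0 fp
            nonequilibrium_initial(3)[of p1 \<rho> p4 X] assms(1,3)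
          by auto
      next
        case False
        then have "X = (\<lambda>_. (0, \<rho>, 0))"
          using X fp by (auto simp: nonequilibrium_solution_def)
        then show ?thesis
          by simp
      qed
    qed
  qed
  have elliptic: ?F4 ?F5 ?O3 ?L3 if "p1 < p4"
  proof -
    have k: "\<kappa> > 1"
      using assms that by simp
    then have k2: "(inverse \<kappa>)\<^sup>2 \<le> 1"
      by (simp add: power_le_one inverse_le_1_iff)
    show fp: ?F4 ?F5
      using k2 \<kappa> by (auto simp: fixed_iff power_mult_distrib field_simps power2_eq_square)
    have nf: "(R0, I0) \<noteq> (inverse \<kappa> * \<rho>, 0)"
      if "(D0, R0, I0) \<in> S2 \<rho>"
        "(D0, R0, I0) \<notin> {(\<rho> * sqrt (1 - (inverse \<kappa>)\<^sup>2), inverse \<kappa> * \<rho>, 0),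
          (- (\<rho> * sqrt (1 - (inverse \<kappa>)\<^sup>2)), inverse \<kappa> * \<rho>, 0)}"
      for D0 R0 I0
    proof
      assume *: "(R0, I0) = (inverse \<kappa> * \<rho>, 0)"
      with that(1) have "D0\<^sup>2 = \<rho>\<^sup>2 - (inverse \<kappa> * \<rho>)\<^sup>2"
        by (auto simp: S2_def)
      also have "\<dots> = (\<rho> * sqrt (1 - (inverse \<kappa>)\<^sup>2))\<^sup>2"
        using k2 by (simp add: power_mult_distrib algebra_simps)
      finally show False
        using that(2) * by (auto simp: power2_eq_iff)
    qed
    note orbit = elliptic_orbit[OF assms(1,3) k p4 _ nf]
    show ?O3
      unfolding Let_def by (intro allI impI, elim conjE, intro conjI allI impI)
        (rule orbit(1,2); assumption)+
    show ?L3
    proof (intro allI impI)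
      fix X assume "nonequilibrium_solution p1 p4 \<rho> X"
      then obtain D0 R0 I0 where X: "solution p1 p4 \<rho> X" "X 0 = (D0, R0, I0)"
        "(D0, R0, I0) \<in> S2 \<rho>" "\<not> fixed_point p1 p4 \<rho> (D0, R0, I0)"
        by (rule initial)
      then show "\<exists>T>0. periodic_fun_simple X T"
        using fp by (intro orbit(3)[OF X(3,3) _ X(1,2)]) auto
    qed
  qed
  show ?thesis
    using hyperbolic parabolic elliptic by (intro conjI impI)
qed

end
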